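(* Let $X = \bigcup_{n=1}^N R^X_n$ and $B = \bigcup_{m=1}^M R^B_m$ be two binary images in $\mathbb{Z}^2$ given in compact run-length representation (with $M \geq 1$), and let $$L_{\min} := \min_{m \in \{1,\ldots,M\}} |R^B_m|, \qquad X_{L_{\min}} := \bigcup_{\substack{1 \leq n \leq N \\ |R^X_n| \geq L_{\min}}} R^X_n .$$ Then $$\varepsilon_B(X) = \varepsilon_B(X_{L_{\min}}).$$
   Context: A binary image is a set of pixels, i.e. a subset of $\mathbb{Z}^2$. For $B \subseteq \mathbb{Z}^2$ and $p \in \mathbb{Z}^2$, $B_p := \{b + p \mid b \in B\}$ is the translate of $B$ by $p$. The erosion of $X \subseteq \mathbb{Z}^2$ by $B \subseteq \mathbb{Z}^2$ is $\varepsilon_B(X) := \{p \in \mathbb{Z}^2 \mid B_p \subseteq X\}$. A run is a nonempty horizontal segment of pixels $\langle lx, rx, y\rangle := \{(lx,y),(lx+1,y),\ldots,(rx,y)\}$ with integers $lx \leq rx$ and $y$; $|R|$ denotes the number of pixels of a run $R$. A run-length representation of a (finite) image $Z \subseteq \mathbb{Z}^2$ is a finite family of runs $R_1,\ldots,R_N$ with $Z = \bigcup_{n=1}^N R_n$. It is compact if horizontally contiguous pixels always form a single run (are not divided into several runs) and runs do not overlap; i.e. the runs are exactly the distinct maximal horizontal segments of $Z$. *)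

theory Defs
  imports Complex_Main "HOL-Library.Product_Plus"
begin

type_synonym pixel = "int \<times> int"

definition translate :: "pixel set \<Rightarrow> pixel \<Rightarrow> pixel set" where
  "translate B p = {b + p | b. b \<in> B}"

definition erosion :: "pixel set \<Rightarrow> pixel set \<Rightarrow> pixel set" where
  "erosion B X = {p. translate B p \<subseteq> X}"

definition segment :: "int \<Rightarrow> int \<Rightarrow> int \<Rightarrow> pixel set" where
  "segment lx rx y = {(x, y) | x. lx \<le> x \<and> x \<le> rx}"

definition is_run :: "pixel set \<Rightarrow> bool" where
  "is_run S \<longleftrightarrow> (\<exists>lx rx y. lx \<le> rx \<and> S = segment lx rx y)"

text \<open>The family of runs is \<open>R 1, \<dots>, R N\<close>; values of \<open>R\<close> at other indices are irrelevant.
  The case \<open>N = 0\<close> represents the empty image.\<close>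

definition run_length_rep :: "nat \<Rightarrow> (nat \<Rightarrow> pixel set) \<Rightarrow> pixel set \<Rightarrow> bool" where
  "run_length_rep N R Z \<longleftrightarrow> (\<forall>n\<in>{1..N}. is_run (R n)) \<and> Z = (\<Union>n\<in>{1..N}. R n)"

text \<open>Compactness: horizontally adjacent pixels of the image lie in a common run, and runs with
  different indices do not overlap. The lemma \<open>compact_iff_maximal\<close> below shows that
  this says exactly that the runs are the maximal horizontal segments of the image, each listed
  once.\<close>

definition compact_run_length_rep :: "nat \<Rightarrow> (nat \<Rightarrow> pixel set) \<Rightarrow> pixel set \<Rightarrow> bool" where
  "compact_run_length_rep N R Z \<longleftrightarrow>
     run_length_rep N R Z \<and>
     (\<forall>x y. (x, y) \<in> Z \<and> (x + 1, y) \<in> Z \<longrightarrow> (\<exists>n\<in>{1..N}. (x, y) \<in> R n \<and> (x + 1, y) \<in> R n)) \<and>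
     (\<forall>n\<in>{1..N}. \<forall>m\<in>{1..N}. n \<noteq> m \<longrightarrow> R n \<inter> R m = {})"

definition min_run_size :: "nat \<Rightarrow> (nat \<Rightarrow> pixel set) \<Rightarrow> nat" where
  "min_run_size M R = Min {card (R m) | m. m \<in> {1..M}}"

definition long_runs_image :: "nat \<Rightarrow> (nat \<Rightarrow> pixel set) \<Rightarrow> nat \<Rightarrow> pixel set" where
  "long_runs_image N R L = (\<Union>n\<in>{n \<in> {1..N}. card (R n) \<ge> L}. R n)"

definition maximal_segment :: "pixel set \<Rightarrow> pixel set \<Rightarrow> bool" where
  "maximal_segment Z S \<longleftrightarrow> is_run S \<and> S \<subseteq> Z \<and> (\<forall>T. is_run T \<and> S \<subseteq> T \<and> T \<subseteq> Z \<longrightarrow> T = S)"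

lemma mem_segment [simp]: "(x, y') \<in> segment lx rx y \<longleftrightarrow> y' = y \<and> lx \<le> x \<and> x \<le> rx"
  by (auto simp: segment_def)

lemma run_nonempty: "is_run S \<Longrightarrow> S \<noteq> {}"
  by (force simp: is_run_def segment_def)

lemma run_in_single_run:
  assumes c: "compact_run_length_rep N R Z" and T: "is_run T" "T \<subseteq> Z"
  shows "\<exists>n\<in>{1..N}. T \<subseteq> R n"
proof -
  obtain l r y where lr: "l \<le> r" and T_eq: "T = segment l r y"
    using T(1) by (auto simp: is_run_def)
  have "\<exists>n\<in>{1..N}. segment l r' y \<subseteq> R n" if "l \<le> r'" "r' \<le> r" for r'
    using that
  proof (induction r' rule: int_ge_induct)
    case base
    have "(l, y) \<in> Z" using T(2) T_eq lr by auto
    then obtain n where "n \<in> {1..N}" "(l, y) \<in> R n"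
      using c unfolding compact_run_length_rep_def run_length_rep_def by blast
    then show ?case by (force simp: segment_def)
  next
    case (step i)
    then obtain n where n: "n \<in> {1..N}" "segment l i y \<subseteq> R n" by auto
    have "(i, y) \<in> Z" "(i + 1, y) \<in> Z" using T(2) T_eq step by auto
    then obtain m where m: "m \<in> {1..N}" "(i, y) \<in> R m" "(i + 1, y) \<in> R m"
      using c unfolding compact_run_length_rep_def by blast
    have "(i, y) \<in> R n" using n(2) step by auto
    then have "n = m" using c n(1) m unfolding compact_run_length_rep_def by blast
    moreover have "segment l (i + 1) y \<subseteq> insert (i + 1, y) (segment l i y)"
      by (auto simp: segment_def)
    ultimately show ?case using n m by blast
  qed
  then show ?thesis using lr T_eq by blast
qed

lemma compact_iff_maximal:
  "compact_run_length_rep N R Z \<longleftrightarrow>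
     run_length_rep N R Z \<and> inj_on R {1..N} \<and> R ` {1..N} = {S. maximal_segment Z S}"
proof (intro iffI conjI)
  assume c: "compact_run_length_rep N R Z"
  show rl: "run_length_rep N R Z" using c by (simp add: compact_run_length_rep_def)
  then have runs: "is_run (R n)" "R n \<subseteq> Z" if "n \<in> {1..N}" for n
    using that unfolding run_length_rep_def by auto
  have disj: "n = m" if "n \<in> {1..N}" "m \<in> {1..N}" "R n \<subseteq> R m" for n m
    using c that run_nonempty[OF runs(1)[OF that(1)]] unfolding compact_run_length_rep_def by blast
  then show "inj_on R {1..N}" by (auto intro!: inj_onI)
  show "R ` {1..N} = {S. maximal_segment Z S}"
  proof (intro equalityI subsetI)
    fix S assume "S \<in> R ` {1..N}"
    then obtain n where n: "n \<in> {1..N}" "S = R n" by blast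
    have "T = S" if T: "is_run T" "S \<subseteq> T" "T \<subseteq> Z" for T
    proof -
      obtain m where "m \<in> {1..N}" "T \<subseteq> R m" using run_in_single_run[OF c T(1,3)] by blast
      then show ?thesis using disj n T(2) by blast
    qed
    then show "S \<in> {S. maximal_segment Z S}" using runs n by (auto simp: maximal_segment_def)
  next
    fix S assume "S \<in> {S. maximal_segment Z S}"
    then have S: "is_run S" "S \<subseteq> Z" and mx: "\<And>T. is_run T \<Longrightarrow> S \<subseteq> T \<Longrightarrow> T \<subseteq> Z \<Longrightarrow> T = S"
      by (auto simp: maximal_segment_def)
    obtain n where "n \<in> {1..N}" "S \<subseteq> R n" using run_in_single_run[OF c S] by blast
    then show "S \<in> R ` {1..N}" using mx runs by blast
  qed
next
  assume a: "run_length_rep N R Z \<and> inj_on R {1..N} \<and> R ` {1..N} = {S. maximal_segment Z S}"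
  then have rl: "run_length_rep N R Z" and inj: "inj_on R {1..N}"
    and img: "R ` {1..N} = {S. maximal_segment Z S}" by blast+
  have mx: "T = R n" if "n \<in> {1..N}" "is_run T" "R n \<subseteq> T" "T \<subseteq> Z" for n T
    using img that unfolding maximal_segment_def by blast
  have runs: "is_run (R n)" "R n \<subseteq> Z" if "n \<in> {1..N}" for n
    using rl that unfolding run_length_rep_def by auto
  have key: "n = m" if nm: "n \<in> {1..N}" "m \<in> {1..N}" and xy: "(x, y) \<in> R n" "(x', y) \<in> R m"
    and adj: "x' = x \<or> x' = x + 1" for n m x x' y
  proof -
    obtain l r where 1: "R n = segment l r y" "l \<le> x" "x \<le> r"
      using runs(1)[OF nm(1)] xy(1) unfolding is_run_def by auto
    obtain l' r' where 2: "R m = segment l' r' y" "l' \<le> x'" "x' \<le> r'"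
      using runs(1)[OF nm(2)] xy(2) unfolding is_run_def by auto
    have U: "segment (min l l') (max r r') y = R n \<union> R m"
      using 1 2 adj by (auto simp: segment_def)
    have run: "is_run (R n \<union> R m)"
      unfolding is_run_def U[symmetric]
      by (rule exI[of _ "min l l'"], rule exI[of _ "max r r'"], rule exI[of _ y]) (use 1 2 in auto)
    have sub: "R n \<union> R m \<subseteq> Z" using runs(2) nm by simp
    have "R n \<union> R m = R n" by (rule mx[OF nm(1) run _ sub]) simp
    moreover have "R n \<union> R m = R m" by (rule mx[OF nm(2) run _ sub]) simp
    ultimately have "R n = R m" by (rule trans[OF sym])
    then show "n = m" using inj nm by (blast dest: inj_onD)
  qed
  have Z: "Z = (\<Union>n\<in>{1..N}. R n)" using rl by (simp add: run_length_rep_def)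
  show "compact_run_length_rep N R Z"
    unfolding compact_run_length_rep_def
  proof (intro conjI allI impI ballI)
    show "run_length_rep N R Z" by (fact rl)
    fix x y assume xy: "(x, y) \<in> Z \<and> (x + 1, y) \<in> Z"
    then obtain n m where n: "n \<in> {1..N}" "(x, y) \<in> R n" and m: "m \<in> {1..N}" "(x + 1, y) \<in> R m"
      unfolding Z UN_iff by blast
    have "n = m" using key[OF n(1) m(1) n(2) m(2)] by simp
    then show "\<exists>n\<in>{1..N}. (x, y) \<in> R n \<and> (x + 1, y) \<in> R n" using n m(2) by (intro bexI conjI) simp_all
  next
    fix n m assume nm: "n \<in> {1..N}" "m \<in> {1..N}" "n \<noteq> m"
    have False if "p \<in> R n" "p \<in> R m" for p
      using key[OF nm(1,2), of "fst p" "snd p" "fst p"] that nm(3) by simp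
    then show "R n \<inter> R m = {}" by (intro equals0I) (elim IntE)
  qed
qed

end

(* A translate of a run of B that lies in X is a run, hence lies in a single run of X, which is
   then at least as long as the shortest run of B. So B_p never meets the short runs of X. *)
theory Submission
  imports Defs
begin

text \<open>Discarding runs shrinks the image, so only one inclusion has content. If
  \<open>translate B p\<close> lies in \<open>X\<close>, view it as the union of the translated runs
  of \<open>B\<close>. Each is again a run (\<open>is_run_translate\<close>) of unchanged size
  (\<open>card_translate\<close>), so by \<open>run_in_single_run\<close> it fits inside one run of
  \<open>X\<close>. That run has at least \<open>min_run_size M RB\<close> pixels and survives the
  filter.\<close>

lemma translate_eq_image: "translate S p = (\<lambda>b. b + p) ` S"
  by (auto simp: translate_def)

lemma card_translate: "card (translate S p) = card S"
  by (simp add: translate_eq_image card_image inj_on_def)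

text \<open>Makes \<open>card\<close> monotone on subsets of a run; infinite sets have
  \<open>card\<close> 0.\<close>

lemma finite_run: "is_run S \<Longrightarrow> finite S"
  by (auto simp: is_run_def segment_def intro: finite_subset[of _ "(\<lambda>x. (x, y)) ` {lx..rx}" for lx rx y])

lemma translate_segment: "translate (segment lx rx y) (a, b) = segment (lx + a) (rx + a) (y + b)"
proof (intro equalityI subsetI)
  fix q assume "q \<in> segment (lx + a) (rx + a) (y + b)"
  \<comment> \<open>The preimage of \<open>q\<close> is \<open>q\<close> shifted back.\<close>
  then have "q - (a, b) \<in> segment lx rx y" by (cases q) auto
  then show "q \<in> translate (segment lx rx y) (a, b)"
    unfolding translate_eq_image by (rule rev_image_eqI) simp
qed (auto simp: translate_def segment_def)

lemma is_run_translate: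
  assumes "is_run S"
  shows "is_run (translate S p)"
proof -
  obtain lx rx y where "lx \<le> rx" "S = segment lx rx y"
    using assms by (auto simp: is_run_def)
  moreover obtain a b where "p = (a, b)" by (cases p)
  ultimately show ?thesis
    unfolding is_run_def
    by (intro exI[of _ "lx + a"] exI[of _ "rx + a"] exI[of _ "y + b"]) (simp add: translate_segment)
qed

lemma min_run_size_le: "m \<in> {1..M} \<Longrightarrow> min_run_size M R \<le> card (R m)"
  unfolding min_run_size_def by (rule Min_le) (auto simp: Setcompr_eq_image)

theorem theorem2:
  fixes X B :: "pixel set" and N M :: nat and RX RB :: "nat \<Rightarrow> pixel set"
  assumes "compact_run_length_rep N RX X"
    and "compact_run_length_rep M RB B"
    and "M \<ge> 1"
  shows "erosion B X = erosion B (long_runs_image N RX (min_run_size M RB))"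
proof -
  let ?L = "min_run_size M RB"
  have X: "X = (\<Union>n\<in>{1..N}. RX n)" and runX: "\<And>n. n \<in> {1..N} \<Longrightarrow> is_run (RX n)"
    using assms(1) unfolding compact_run_length_rep_def run_length_rep_def by blast+
  have B: "B = (\<Union>m\<in>{1..M}. RB m)" and runB: "\<And>m. m \<in> {1..M} \<Longrightarrow> is_run (RB m)"
    using assms(2) unfolding compact_run_length_rep_def run_length_rep_def by blast+
  have "translate B p \<subseteq> long_runs_image N RX ?L" if sub: "translate B p \<subseteq> X" for p
  proof
    fix q assume "q \<in> translate B p"
    then obtain m where m: "m \<in> {1..M}" and q: "q \<in> translate (RB m) p"
      unfolding B translate_def by blast
    have "translate (RB m) p \<subseteq> X"
      using sub m unfolding B translate_def by blast
    \<comment> \<open>Compactness of the representation of \<open>X\<close> enters here: otherwise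
      the translate could be spread over several short runs.\<close>
    then obtain n where n: "n \<in> {1..N}" and sub_n: "translate (RB m) p \<subseteq> RX n"
      using run_in_single_run[OF assms(1) is_run_translate[OF runB[OF m]]] by blast
    have "?L \<le> card (translate (RB m) p)"
      using min_run_size_le[OF m] by (simp add: card_translate)
    also have "\<dots> \<le> card (RX n)"
      by (rule card_mono[OF finite_run[OF runX[OF n]] sub_n])
    finally show "q \<in> long_runs_image N RX ?L"
      using n q sub_n unfolding long_runs_image_def by blast
  qed
  \<comment> \<open>Gives the converse inclusion, as erosion is monotone in the image.\<close>
  moreover have "long_runs_image N RX ?L \<subseteq> X"
    unfolding long_runs_image_def X by blast
  ultimately show ?thesis
    unfolding erosion_def by blast
qed

end
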